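(* Let $q\ge 2$ be an integer and let $\theta=(\theta(n))_{n\in\mathbb N}$ be a $q$-multiplicative sequence with empty spectrum. Then, for every real number $\alpha$, $$\lim_{N\to+\infty}\frac1N\sum_{k=1}^{N}\theta(k)e^{2i\pi k^2\alpha}=0.$$
   Context: $\mathbb N=\{0,1,2,\dots\}$. For an integer $q\ge2$, a $q$-multiplicative sequence is a sequence $\theta=(\theta(n))_{n\in\mathbb N}$ of complex numbers of modulus $1$ such that for all integers $t\ge1$ and all $(a,b)\in\mathbb N^2$ with $b<q^t$, $\theta(aq^t+b)=\theta(aq^t)\theta(b)$. The sequence $\theta$ has empty spectrum if for all $x\in\mathbb R$, $\lim_{N\to+\infty}\frac1N\sum_{n=0}^{N-1}\theta(n)e^{2i\pi nx}=0$. *)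

theory Defs
  imports "HOL-Analysis.Analysis"
begin

definition q_multiplicative :: "nat \<Rightarrow> (nat \<Rightarrow> complex) \<Rightarrow> bool" where
  "q_multiplicative q \<theta> \<longleftrightarrow>
     (\<forall>n. cmod (\<theta> n) = 1) \<and>
     (\<forall>t\<ge>1. \<forall>a b. b < q ^ t \<longrightarrow> \<theta> (a * q ^ t + b) = \<theta> (a * q ^ t) * \<theta> b)"

definition empty_spectrum :: "(nat \<Rightarrow> complex) \<Rightarrow> bool" where
  "empty_spectrum \<theta> \<longleftrightarrow>
     (\<forall>x::real. (\<lambda>N::nat. 1 / of_nat N *
        (\<Sum>n<N. \<theta> n * exp (2 * \<i> * of_real pi * of_nat n * of_real x))) \<longlonglongrightarrow> 0)"

end

theory Submission
  imports Defs
begin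

text \<open>
  If \<open>\<alpha> = a / d\<close> is rational, \<open>exp (2\<pi>ik\<^sup>2\<alpha>)\<close> is \<open>d\<close>-periodic in \<open>k\<close>, hence a linear combination of
  characters \<open>exp (2\<pi>ijk/d)\<close>, and the empty spectrum gives the claim.  If \<open>\<alpha>\<close> is irrational, van der
  Corput's inequality reduces the claim to the correlations of \<open>\<theta> (k + h) * cnj (\<theta> k)\<close> with
  \<open>exp (4\<pi>ihk\<alpha>)\<close>.  Multiplicativity makes the former agree with a \<open>q ^ t\<close>-periodic sequence
  except when adding \<open>h\<close> to \<open>k\<close> carries beyond the \<open>t\<close> lowest digits, a set of density at most
  \<open>h / q ^ t\<close>; and periodic sequences do not correlate with an irrational character.
\<close>

section \<open>Sequences with vanishing Cesaro means\<close>

definition cesaro_null :: "(nat \<Rightarrow> complex) \<Rightarrow> bool" where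
  "cesaro_null u \<longleftrightarrow> (\<lambda>N. (\<Sum>n<N. u n) / of_nat N) \<longlonglongrightarrow> 0"

text \<open>The constant \<open>C\<close> absorbs the finitely many small \<open>N\<close>, so
  estimates hold for every \<open>N\<close> and errors independent of \<open>N\<close> can simply be
  added to \<open>C\<close>.\<close>

lemma cesaro_null_iff_bound:
  "cesaro_null u \<longleftrightarrow> (\<forall>\<epsilon>>0. \<exists>C\<ge>0. \<forall>N. cmod (\<Sum>n<N. u n) \<le> \<epsilon> * real N + C)"
proof (intro iffI allI impI)
  fix \<epsilon> :: real
  assume "cesaro_null u" and \<epsilon>: "\<epsilon> > 0"
  then obtain N0 where N0: "\<And>N. N \<ge> N0 \<Longrightarrow> cmod ((\<Sum>n<N. u n) / of_nat N) < \<epsilon>"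
    unfolding cesaro_null_def LIMSEQ_iff by fastforce
  define C where "C = (\<Sum>N<N0. cmod (\<Sum>n<N. u n))"
  have C0: "C \<ge> 0" by (simp add: C_def sum_nonneg)
  have "cmod (\<Sum>n<N. u n) \<le> \<epsilon> * real N + C" for N
  proof (cases "N < N0")
    case True
    then have "cmod (\<Sum>n<N. u n) \<le> C"
      unfolding C_def by (intro member_le_sum) auto
    then show ?thesis using \<epsilon> by (simp add: add_increasing)
  next
    case False
    show ?thesis
    proof (cases "N = 0")
      case True
      then show ?thesis using C0 by simp
    next
      case nz: False
      from False N0[of N] have "cmod (\<Sum>n<N. u n) / real N < \<epsilon>"
        by (simp add: norm_divide)
      then show ?thesis using nz C0 by (simp add: divide_less_eq)
    qed
  qed
  with C0 show "\<exists>C\<ge>0. \<forall>N. cmod (\<Sum>n<N. u n) \<le> \<epsilon> * real N + C" by blast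
next
  assume bound: "\<forall>\<epsilon>>0. \<exists>C\<ge>0. \<forall>N. cmod (\<Sum>n<N. u n) \<le> \<epsilon> * real N + C"
  show "cesaro_null u"
    unfolding cesaro_null_def LIMSEQ_iff
  proof (intro allI impI)
    fix r :: real assume r: "r > 0"
    obtain C where C: "C \<ge> 0" "\<And>N. cmod (\<Sum>n<N. u n) \<le> r / 2 * real N + C"
      using bound r half_gt_zero by blast
    obtain N0 :: nat where N0: "real N0 > 2 * C / r"
      using reals_Archimedean2 by blast
    have "cmod ((\<Sum>n<N. u n) / of_nat N - 0) < r" if N: "N \<ge> N0" for N
    proof -
      have "real N > 2 * C / r" using N N0 by linarith
      then have "C < r / 2 * real N" using r by (simp add: field_simps)
      with C(2)[of N] have less: "cmod (\<Sum>n<N. u n) < r * real N" by linarith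
      then have "N > 0" by (cases "N = 0") auto
      with less show ?thesis by (simp add: norm_divide divide_less_eq)
    qed
    then show "\<exists>N0. \<forall>N\<ge>N0. cmod ((\<Sum>n<N. u n) / of_nat N - 0) < r" by blast
  qed
qed

lemma cesaro_null_add:
  assumes "cesaro_null u" "cesaro_null v"
  shows "cesaro_null (\<lambda>n. u n + v n)"
  using tendsto_add[OF assms[unfolded cesaro_null_def]]
  by (simp add: cesaro_null_def sum.distrib add_divide_distrib)

lemma cesaro_null_cmult:
  assumes "cesaro_null u"
  shows "cesaro_null (\<lambda>n. c * u n)"
  using tendsto_mult_left[OF assms[unfolded cesaro_null_def], of c]
  by (simp add: cesaro_null_def sum_distrib_left)

lemma cesaro_null_sum:
  assumes "\<And>i. i \<in> I \<Longrightarrow> cesaro_null (u i)"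
  shows "cesaro_null (\<lambda>n. \<Sum>i\<in>I. u i n)"
  using assms
proof (induction I rule: infinite_finite_induct)
  case (insert i I)
  then show ?case by (simp add: cesaro_null_add)
qed (simp_all add: cesaro_null_def)

lemma cesaro_null_cnj:
  assumes "cesaro_null u"
  shows "cesaro_null (\<lambda>n. cnj (u n))"
  using tendsto_cnj[OF assms[unfolded cesaro_null_def]]
  by (simp add: cesaro_null_def)

text \<open>Shifting by \<open>s\<close> only affects the ends: \<open>s\<close> terms enter on the
  right and \<open>s\<close> leave on the left.\<close>

lemma norm_sum_shift_diff_le:
  fixes u :: "nat \<Rightarrow> complex"
  assumes "\<And>n. cmod (u n) \<le> B"
  shows "cmod ((\<Sum>n<N. u (n + s)) - (\<Sum>n<N. u n)) \<le> 2 * real s * B"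
proof -
  have split: "(\<Sum>n<i+j. u n) = (\<Sum>n<i. u n) + (\<Sum>n<j. u (i + n))" for i j
    by (induction j) (simp_all add: add.assoc)
  have bd: "cmod (\<Sum>n<s. u (f n)) \<le> real s * B" for f
    using sum_norm_bound[of "{..<s}" "\<lambda>n. u (f n)" B] assms by simp
  \<comment> \<open>Both sides come from splitting the sum over \<open>N + s\<close> terms, once
    after \<open>N\<close> and once after \<open>s\<close>; no relation between \<open>s\<close> and
    \<open>N\<close> is assumed.\<close>
  have "(\<Sum>n<N. u (n + s)) - (\<Sum>n<N. u n) = (\<Sum>n<s. u (N + n)) - (\<Sum>n<s. u n)"
    using split[of N s] split[of s N] by (simp add: add.commute algebra_simps)
  also have "cmod \<dots> \<le> real s * B + real s * B"
    by (intro order_trans[OF norm_triangle_ineq4] add_mono bd)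
  finally show ?thesis by (simp add: mult.commute)
qed

text \<open>Used for shifts and, with \<open>u\<close> the zero sequence, for sequences whose
  partial sums are bounded.\<close>

lemma cesaro_null_of_bounded_diff:
  assumes "cesaro_null u"
    and "\<And>N. cmod ((\<Sum>n<N. v n) - (\<Sum>n<N. u n)) \<le> K"
  shows "cesaro_null v"
  unfolding cesaro_null_iff_bound
proof (intro allI impI)
  fix \<epsilon> :: real assume "\<epsilon> > 0"
  then obtain C where C: "C \<ge> 0" "\<And>N. cmod (\<Sum>n<N. u n) \<le> \<epsilon> * real N + C"
    using assms(1) unfolding cesaro_null_iff_bound by blast
  have "K \<ge> 0" using assms(2)[of 0] by simp
  have "cmod (\<Sum>n<N. v n) \<le> \<epsilon> * real N + (C + K)" for N
    using C(2)[of N] assms(2)[of N] norm_triangle_sub[of "\<Sum>n<N. v n" "\<Sum>n<N. u n"] by linarith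
  then show "\<exists>C\<ge>0. \<forall>N. cmod (\<Sum>n<N. v n) \<le> \<epsilon> * real N + C"
    using C(1) \<open>K \<ge> 0\<close> by (intro exI[of _ "C + K"]) auto
qed

lemma cesaro_null_shift:
  assumes "cesaro_null u" "\<And>n. cmod (u n) \<le> B"
  shows "cesaro_null (\<lambda>n. u (n + s))"
  by (rule cesaro_null_of_bounded_diff[OF assms(1)], rule norm_sum_shift_diff_le) (rule assms(2))

text \<open>The class is closed under approximation in mean. The approximant \<open>w\<close> may
  depend on \<epsilon>; below it is a periodic sequence times a character.\<close>

lemma cesaro_null_approx:
  assumes "\<And>\<epsilon>. \<epsilon> > 0 \<Longrightarrow> \<exists>w C. cesaro_null w \<and> (\<forall>N. (\<Sum>n<N. cmod (u n - w n)) \<le> \<epsilon> * real N + C)"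
  shows "cesaro_null u"
  unfolding cesaro_null_iff_bound
proof (intro allI impI)
  fix \<epsilon> :: real assume \<epsilon>: "\<epsilon> > 0"
  obtain w C where w: "cesaro_null w" "\<And>N. (\<Sum>n<N. cmod (u n - w n)) \<le> \<epsilon> / 2 * real N + C"
    using assms[of "\<epsilon> / 2"] \<epsilon> by auto
  obtain D where D: "D \<ge> 0" "\<And>N. cmod (\<Sum>n<N. w n) \<le> \<epsilon> / 2 * real N + D"
    using w(1) \<epsilon> half_gt_zero unfolding cesaro_null_iff_bound by blast
  have "C \<ge> 0" using w(2)[of 0] by simp
  have "cmod (\<Sum>n<N. u n) \<le> \<epsilon> * real N + (C + D)" for N
  proof -
    have "cmod ((\<Sum>n<N. u n) - (\<Sum>n<N. w n)) \<le> (\<Sum>n<N. cmod (u n - w n))"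
      by (simp add: norm_sum flip: sum_subtractf)
    then show ?thesis
      using w(2)[of N] D(2)[of N] norm_triangle_sub[of "\<Sum>n<N. u n" "\<Sum>n<N. w n"] by linarith
  qed
  then show "\<exists>C\<ge>0. \<forall>N. cmod (\<Sum>n<N. u n) \<le> \<epsilon> * real N + C"
    using D(1) \<open>C \<ge> 0\<close> by (intro exI[of _ "C + D"]) auto
qed

section \<open>Van der Corput's inequality\<close>

text \<open>Each of the \<open>H\<close> shifted sums differs from the original by at most
  \<open>2 * H\<close>, which gives the error \<open>2 * H ^ 2\<close>.\<close>

lemma norm_sum_le_window:
  fixes u :: "nat \<Rightarrow> complex"
  assumes "\<And>n. cmod (u n) \<le> 1"
  shows "real H * cmod (\<Sum>n<N. u n) \<le> cmod (\<Sum>n<N. \<Sum>h<H. u (n + h)) + 2 * real H ^ 2"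
proof -
  have "(\<Sum>n<N. \<Sum>h<H. u (n + h)) - of_nat H * (\<Sum>n<N. u n)
      = (\<Sum>h<H. (\<Sum>n<N. u (n + h)) - (\<Sum>n<N. u n))"
    by (subst sum.swap) (simp add: sum_subtractf)
  also have "cmod \<dots> \<le> real (card {..<H}) * (2 * real H)"
  proof (rule sum_norm_bound)
    fix h assume "h \<in> {..<H}"
    then show "cmod ((\<Sum>n<N. u (n + h)) - (\<Sum>n<N. u n)) \<le> 2 * real H"
      using norm_sum_shift_diff_le[where u = u and B = 1 and N = N and s = h] assms by simp
  qed
  finally have "cmod (of_nat H * (\<Sum>n<N. u n) - (\<Sum>n<N. \<Sum>h<H. u (n + h))) \<le> 2 * real H ^ 2"
    by (simp add: norm_minus_commute power2_eq_square algebra_simps)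
  then show ?thesis
    using norm_triangle_sub[of "of_nat H * (\<Sum>n<N. u n)" "\<Sum>n<N. \<Sum>h<H. u (n + h)"]
    by (simp add: norm_mult)
qed

text \<open>The Cauchy-Schwarz inequality against the constant sequence 1.\<close>

lemma norm_sum_squared_le:
  fixes A :: "nat \<Rightarrow> complex"
  shows "(cmod (\<Sum>n<N. A n))\<^sup>2 \<le> real N * (\<Sum>n<N. (cmod (A n))\<^sup>2)"
proof -
  have "(cmod (\<Sum>n<N. A n))\<^sup>2 \<le> (\<Sum>n<N. cmod (A n))\<^sup>2"
    by (simp add: power_mono norm_sum)
  also have "\<dots> \<le> real N * (\<Sum>n<N. (cmod (A n))\<^sup>2)"
    using sum_squared_le_sum_of_squares[of "\<lambda>n. cmod (A n)" "{..<N}"]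
    by (simp add: mult.commute)
  finally show ?thesis .
qed

text \<open>Expanding the square separates the diagonal, which is trivially bounded, from the
  correlations at nonzero lag. The identity lives in the complex numbers because single correlation
  terms need not be real.\<close>

lemma sum_norm_squared_window:
  fixes u :: "nat \<Rightarrow> complex"
  shows "complex_of_real (\<Sum>n<N. (cmod (\<Sum>h<H. u (n + h)))\<^sup>2)
       = (\<Sum>n<N. \<Sum>h<H. u (n + h) * cnj (u (n + h)))
       + (\<Sum>n<N. \<Sum>(h, k) \<in> {(h, k). h < H \<and> k < H \<and> h \<noteq> k}. u (n + h) * cnj (u (n + k)))"
proof -
  have sq: "complex_of_real ((cmod (\<Sum>h<H. u (n + h)))\<^sup>2)
      = (\<Sum>h<H. u (n + h) * cnj (u (n + h)))
      + (\<Sum>(h, k) \<in> {(h, k). h < H \<and> k < H \<and> h \<noteq> k}. u (n + h) * cnj (u (n + k)))" for n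
  proof -
    let ?f = "\<lambda>(h, k). u (n + h) * cnj (u (n + k))"
    let ?D = "(\<lambda>h. (h, h)) ` {..<H}" and ?O = "{(h, k). h < H \<and> k < H \<and> h \<noteq> k}"
    have un: "{..<H} \<times> {..<H} = ?D \<union> ?O" by auto
    have fin: "finite ?O" by (rule finite_subset[of _ "{..<H} \<times> {..<H}"]) auto
    have "complex_of_real ((cmod (\<Sum>h<H. u (n + h)))\<^sup>2)
        = (\<Sum>h<H. u (n + h)) * cnj (\<Sum>h<H. u (n + h))"
      by (rule complex_norm_square)
    also have "\<dots> = sum ?f ({..<H} \<times> {..<H})"
      by (simp add: sum_product sum.cartesian_product)
    also have "\<dots> = sum ?f ?D + sum ?f ?O"
      unfolding un by (rule sum.union_disjoint) (use fin in auto)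
    also have "sum ?f ?D = (\<Sum>h<H. u (n + h) * cnj (u (n + h)))"
      by (subst sum.reindex) (auto simp: inj_on_def)
    finally show ?thesis .
  qed
  show ?thesis unfolding of_real_sum sq sum.distrib ..
qed

text \<open>Average over windows of length \<open>H\<close> and apply Cauchy-Schwarz: the diagonal
  contributes at most \<open>H * N\<close>, the correlations are negligible, and so the sum of
  \<open>u\<close> is at most \<open>sqrt (2 / H) * N\<close> up to a constant. Then
  \<open>H\<close> is taken large.\<close>

theorem van_der_Corput:
  fixes u :: "nat \<Rightarrow> complex"
  assumes u: "\<And>n. cmod (u n) \<le> 1"
    and corr: "\<And>h. h \<ge> 1 \<Longrightarrow> cesaro_null (\<lambda>n. u (n + h) * cnj (u n))"
  shows "cesaro_null u"
  unfolding cesaro_null_iff_bound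
proof (intro allI impI)
  fix \<epsilon> :: real assume \<epsilon>: "\<epsilon> > 0"
  \<comment> \<open>This makes \<open>sqrt (2 / H)\<close> smaller than \<epsilon>.\<close>
  obtain H :: nat where H: "real H > 2 / \<epsilon>\<^sup>2" using reals_Archimedean2 by blast
  have H0: "real H > 0" using H \<epsilon> by (meson divide_pos_pos order_less_trans zero_less_numeral zero_less_power)
  define offdiag where "offdiag = {(h, k). h < H \<and> k < H \<and> h \<noteq> k}"
  have uu: "cmod (u m * cnj (u n)) \<le> 1" for m n
    using u[of m] u[of n] by (simp add: norm_mult mult_le_one)
  \<comment> \<open>This is the correlation at lag \<open>h - k\<close>, shifted by
    \<open>k\<close>; the case \<open>h < k\<close> follows by conjugation.\<close>
  have shifted: "cesaro_null (\<lambda>n. u (n + h) * cnj (u (n + k)))" if "k < h" for h k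
    using cesaro_null_shift[OF corr[of "h - k"] uu, of k] that by (simp add: add.assoc)
  have "cesaro_null (\<lambda>n. u (n + h) * cnj (u (n + k)))" if "h \<noteq> k" for h k
  proof (cases "k < h")
    case False
    then show ?thesis using cesaro_null_cnj[OF shifted[of h k]] that by (simp add: mult.commute)
  qed (rule shifted)
  then have "cesaro_null (\<lambda>n. \<Sum>(h, k) \<in> offdiag. u (n + h) * cnj (u (n + k)))"
    by (intro cesaro_null_sum) (auto simp: offdiag_def)
  \<comment> \<open>With tolerance \<open>H\<close>, the off-diagonal part gets the same linear
    bound as the diagonal. Together they give \<open>2 * H * N + C\<close>, whence the choice of
    \<open>c\<close> below.\<close>
  then obtain C where C: "C \<ge> 0" "\<And>N. cmod (\<Sum>n<N. \<Sum>(h, k) \<in> offdiag. u (n + h) * cnj (u (n + k)))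
      \<le> real H * real N + C"
    using H0 unfolding cesaro_null_iff_bound by blast
  define c where "c = sqrt (2 * real H)"
  have c: "c > 0" "c\<^sup>2 = 2 * real H" using H0 by (simp_all add: c_def)
  have window: "cmod (\<Sum>n<N. \<Sum>h<H. u (n + h)) \<le> c * real N + C / c" for N
  proof (rule power2_le_imp_le)
    have "(\<Sum>n<N. (cmod (\<Sum>h<H. u (n + h)))\<^sup>2)
        \<le> cmod (complex_of_real (\<Sum>n<N. (cmod (\<Sum>h<H. u (n + h)))\<^sup>2))"
      by (simp only: norm_of_real abs_ge_self)
    also have "\<dots> \<le> cmod (\<Sum>n<N. \<Sum>h<H. u (n + h) * cnj (u (n + h))) + (real H * real N + C)"
      unfolding sum_norm_squared_window offdiag_def[symmetric]
      by (intro order_trans[OF norm_triangle_ineq] add_left_mono C(2))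
    also have "cmod (\<Sum>n<N. \<Sum>h<H. u (n + h) * cnj (u (n + h))) \<le> real N * real H"
      using sum_norm_bound[of "{..<N}" "\<lambda>n. \<Sum>h<H. u (n + h) * cnj (u (n + h))" "real H"]
        sum_norm_bound[of "{..<H}" "\<lambda>h. u (_ + h) * cnj (u (_ + h))" 1] uu by simp
    finally have "(\<Sum>n<N. (cmod (\<Sum>h<H. u (n + h)))\<^sup>2) \<le> c\<^sup>2 * real N + C"
      by (simp add: c algebra_simps)
    then have "(cmod (\<Sum>n<N. \<Sum>h<H. u (n + h)))\<^sup>2 \<le> real N * (c\<^sup>2 * real N + C)"
      by (intro order_trans[OF norm_sum_squared_le] mult_left_mono) simp_all
    \<comment> \<open>Completing the square keeps the bound linear in \<open>N\<close> once the root
      is taken.\<close>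
    also have "\<dots> \<le> (c * real N)\<^sup>2 + 2 * (real N * C) + (C / c)\<^sup>2"
      using C(1) by (simp add: power2_eq_square algebra_simps)
    also have "\<dots> = (c * real N + C / c)\<^sup>2"
      using c(1) by (simp add: power2_sum)
    finally show "(cmod (\<Sum>n<N. \<Sum>h<H. u (n + h)))\<^sup>2 \<le> (c * real N + C / c)\<^sup>2" .
  qed (use c C in auto)
  have "c \<le> \<epsilon> * real H"
  proof (rule power2_le_imp_le)
    have "2 \<le> \<epsilon>\<^sup>2 * real H" using H \<epsilon> by (simp add: field_simps)
    from mult_right_mono[OF this, of "real H"] show "c\<^sup>2 \<le> (\<epsilon> * real H)\<^sup>2"
      unfolding c(2) by (simp add: power2_eq_square algebra_simps)
  qed (use \<epsilon> in simp)
  define K where "K = (C / c + 2 * real H ^ 2) / real H"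
  have "cmod (\<Sum>n<N. u n) \<le> \<epsilon> * real N + K" for N
  proof -
    have "real H * cmod (\<Sum>n<N. u n) \<le> c * real N + C / c + 2 * real H ^ 2"
      using norm_sum_le_window[where u = u and H = H and N = N, OF u] window[of N] by linarith
    also have "\<dots> \<le> (\<epsilon> * real H) * real N + C / c + 2 * real H ^ 2"
      using \<open>c \<le> \<epsilon> * real H\<close> by (simp add: mult_right_mono)
    also have "\<dots> = real H * (\<epsilon> * real N + K)"
      unfolding distrib_left using H0 by (simp add: K_def)
    finally show ?thesis using H0 by simp
  qed
  moreover have "K \<ge> 0" using c C by (simp add: K_def)
  ultimately show "\<exists>C\<ge>0. \<forall>N. cmod (\<Sum>n<N. u n) \<le> \<epsilon> * real N + C" by blast
qed

section \<open>Periodic sequences\<close>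

lemma periodic_add_mult:
  fixes p :: "nat \<Rightarrow> 'a"
  assumes "\<And>n. p (n + d) = p n"
  shows "p (n + m * d) = p n"
proof (induction m)
  case (Suc m)
  then show ?case using assms[of "n + m * d"] by (simp add: algebra_simps)
qed simp

lemma periodic_mod:
  fixes p :: "nat \<Rightarrow> 'a"
  assumes "\<And>n. p (n + d) = p n"
  shows "p (n mod d) = p n"
  using periodic_add_mult[of p d "n mod d" "n div d", OF assms] by (simp add: algebra_simps)

text \<open>Shifting by one period multiplies the partial sum by \<open>z ^ d\<close> but changes it
  only by a bounded amount. As \<open>z ^ d \<noteq> 1\<close>, the partial sums themselves are
  bounded.\<close>

lemma cesaro_null_periodic_mult_power:
  fixes p :: "nat \<Rightarrow> complex" and z :: complex
  assumes p: "\<And>n. p (n + d) = p n" and z: "cmod z = 1" "z ^ d \<noteq> 1"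
  shows "cesaro_null (\<lambda>n. p n * z ^ n)"
proof -
  have d: "d > 0" using z(2) by (cases d) auto
  define B where "B = (\<Sum>n<d. cmod (p n))"
  let ?v = "\<lambda>n. p n * z ^ n"
  have "cmod (?v n) \<le> B" for n
  proof -
    have "cmod (p n) = cmod (p (n mod d))" using periodic_mod[of p d n, OF p] by simp
    also have "\<dots> \<le> B" unfolding B_def using d by (intro member_le_sum) auto
    finally show ?thesis using z(1) by (simp add: norm_mult norm_power)
  qed
  then have shift: "cmod ((\<Sum>n<N. ?v (n + d)) - (\<Sum>n<N. ?v n)) \<le> 2 * real d * B" for N
    by (rule norm_sum_shift_diff_le)
  have "(\<Sum>n<N. ?v (n + d)) - (\<Sum>n<N. ?v n) = (z ^ d - 1) * (\<Sum>n<N. ?v n)" for N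
    by (simp add: p power_add sum_distrib_left sum_subtractf[symmetric] algebra_simps)
  with shift have "cmod (z ^ d - 1) * cmod (\<Sum>n<N. ?v n) \<le> 2 * real d * B" for N
    by (simp add: norm_mult[symmetric])
  then have bd: "cmod ((\<Sum>n<N. ?v n) - (\<Sum>n<N. 0)) \<le> 2 * real d * B / cmod (z ^ d - 1)" for N
    using z(2) by (simp add: field_simps)
  show ?thesis
    by (rule cesaro_null_of_bounded_diff[OF _ bd]) (simp add: cesaro_null_def)
qed

text \<open>Finite Fourier inversion: \<open>c\<close> is the normalized discrete Fourier transform
  of one period of \<open>p\<close>.\<close>

lemma periodic_fourier:
  fixes p :: "nat \<Rightarrow> complex"
  assumes p: "\<And>n. p (n + d) = p n" and d: "d > 0"
  obtains c where "\<And>n. p n = (\<Sum>j<d. c j * cis (2 * pi * real j / real d) ^ n)"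
proof
  fix n
  \<comment> \<open>Orthogonality of characters: the summands are the powers of a
    \<open>d\<close>-th root of unity \<open>z\<close>, so the geometric sum vanishes unless
    \<open>z = 1\<close>.\<close>
  have delta: "(\<Sum>j<d. cis (2 * pi * real j / real d) ^ n * cis (- (2 * pi * real j / real d)) ^ r)
      = (if r = n mod d then of_nat d else 0)" if r: "r < d" for r
  proof -
    define z where "z = cis (2 * pi * (real n - real r) / real d)"
    have eq: "cis (2 * pi * real j / real d) ^ n * cis (- (2 * pi * real j / real d)) ^ r = z ^ j" for j
      unfolding z_def Complex.DeMoivre cis_mult
      by (rule arg_cong[of _ _ cis]) (simp add: field_simps add_divide_distrib diff_divide_distrib)
    have zd: "z ^ d = 1"
    proof -
      have "z ^ d = cis (2 * pi * of_int (int n - int r))"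
        unfolding z_def Complex.DeMoivre using d by simp
      then show ?thesis by (simp only: cis_multiple_2pi Ints_of_int)
    qed
    \<comment> \<open>Here \<open>z = 1\<close> says that \<open>d\<close> divides
      \<open>n - r\<close>. The argument passes to integers since this difference may be
      negative.\<close>
    have z1: "z = 1 \<longleftrightarrow> r = n mod d"
    proof
      assume "z = 1"
      then have "cos (2 * pi * (real n - real r) / real d) = 1"
        unfolding z_def by (simp add: complex_eq_iff)
      then obtain k :: int where "2 * pi * (real n - real r) / real d = of_int k * 2 * pi"
        using cos_one_2pi_int by blast
      then have "2 * pi * (real n - real r) = 2 * pi * (of_int k * real d)"
        using d by (simp add: field_simps)
      then have "real n - real r = of_int k * real d"
        by (subst (asm) mult_cancel_left) simp
      then have "of_int (int n) = (of_int (int r + k * int d) :: real)" by simp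
      then have "int n = int r + k * int d" by (simp only: of_int_eq_iff)
      then have "int n mod int d = int r" using r by simp
      then show "r = n mod d" by (metis nat_int zmod_int)
    next
      assume "r = n mod d"
      then have "real n - real r = real d * real (n div d)"
        by (metis add_diff_cancel_right' mult_div_mod_eq of_nat_add of_nat_mult)
      then have "2 * pi * (real n - real r) / real d = 2 * pi * of_int (int (n div d))"
        using d by (simp add: field_simps)
      then have "z = cis (2 * pi * of_int (int (n div d)))" by (simp only: z_def)
      then show "z = 1" by (simp only: cis_multiple_2pi Ints_of_int)
    qed
    show ?thesis
    proof (cases "z = 1")
      case True
      then show ?thesis unfolding eq using z1 by simp
    next
      case False
      then show ?thesis unfolding eq using z1 zd by (simp add: geometric_sum)
    qed
  qed
  define c where "c j = (\<Sum>r<d. p r * cis (- (2 * pi * real j / real d)) ^ r) / of_nat d" for j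
  have "(\<Sum>j<d. c j * cis (2 * pi * real j / real d) ^ n)
      = (\<Sum>j<d. \<Sum>r<d. p r / of_nat d *
          (cis (2 * pi * real j / real d) ^ n * cis (- (2 * pi * real j / real d)) ^ r))"
    unfolding c_def sum_divide_distrib sum_distrib_right by (intro sum.cong refl) simp
  also have "\<dots> = (\<Sum>r<d. p r / of_nat d * (if r = n mod d then of_nat d else 0))"
    by (subst sum.swap, unfold sum_distrib_left[symmetric], intro sum.cong) (simp_all only: delta lessThan_iff)
  also have "\<dots> = (\<Sum>r<d. if r = n mod d then p r else 0)"
    using d by (intro sum.cong) auto
  also have "\<dots> = p n"
    using d periodic_mod[of p d n, OF p] by simp
  finally show "p n = (\<Sum>j<d. (\<Sum>r<d. p r * cis (- (2 * pi * real j / real d)) ^ r) / of_nat d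
      * cis (2 * pi * real j / real d) ^ n)"
    by (simp add: c_def)
qed

section \<open>Multiplicative sequences and quadratic phases\<close>

text \<open>Writes the characters as powers of a unit complex number, the form in which the Fourier
  expansion produces them.\<close>

lemma empty_spectrumD:
  assumes "empty_spectrum \<theta>"
  shows "cesaro_null (\<lambda>n. \<theta> n * cis (2 * pi * x) ^ n)"
proof -
  have "exp (2 * \<i> * of_real pi * of_nat n * of_real x) = cis (2 * pi * x) ^ n" for n
    unfolding Complex.DeMoivre unfolding cis_conv_exp by (rule arg_cong[of _ _ exp]) simp
  with assms[unfolded empty_spectrum_def, rule_format, of x] show ?thesis
    by (simp add: cesaro_null_def)
qed

text \<open>Fourier expansion of \<open>p\<close> leaves finitely many frequencies
  \<open>j / d\<close>, each handled by the empty spectrum.\<close>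

lemma cesaro_null_empty_spectrum_mult_periodic:
  assumes "empty_spectrum \<theta>" "\<And>n. p (n + d) = p n" "d > 0"
  shows "cesaro_null (\<lambda>n. \<theta> n * p n)"
proof -
  obtain c where c: "\<And>n. p n = (\<Sum>j<d. c j * cis (2 * pi * real j / real d) ^ n)"
    using periodic_fourier[of p d] assms(2,3) by blast
  have "cesaro_null (\<lambda>n. \<Sum>j<d. c j * (\<theta> n * cis (2 * pi * (real j / real d)) ^ n))"
    by (intro cesaro_null_sum cesaro_null_cmult empty_spectrumD assms)
  then show ?thesis by (simp add: c sum_distrib_left mult_ac)
qed

section \<open>Carries and correlations of multiplicative sequences\<close>

lemma card_mod_ge_le:
  fixes N Q h :: nat
  assumes "Q > 0"
  shows "card {n. n < N \<and> Q \<le> n mod Q + h} \<le> (N div Q + 1) * h"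
proof -
  let ?A = "{n. n < N \<and> Q \<le> n mod Q + h}"
  \<comment> \<open>Encode \<open>n\<close> by quotient and remainder modulo \<open>Q\<close>. The
    remainders that carry lie in \<open>{Q - h..<Q}\<close>; truncated subtraction covers
    \<open>h > Q\<close>.\<close>
  have "card ?A \<le> card ({..N div Q} \<times> {Q - h..<Q})"
  proof (rule card_inj_on_le)
    show "inj_on (\<lambda>n. (n div Q, n mod Q)) ?A"
      by (rule inj_onI) (metis div_mult_mod_eq prod.inject)
    show "(\<lambda>n. (n div Q, n mod Q)) ` ?A \<subseteq> {..N div Q} \<times> {Q - h..<Q}"
      using assms by (auto simp: div_le_mono)
  qed simp
  also have "\<dots> = (N div Q + 1) * (Q - (Q - h))"
    by (simp only: card_cartesian_product card_atMost card_atLeastLessThan Suc_eq_plus1)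
  also have "\<dots> \<le> (N div Q + 1) * h" by (rule mult_le_mono2) simp
  finally show ?thesis .
qed

text \<open>Without a carry, \<open>n\<close> and \<open>n + h\<close> share their high digits. The
  common factor has modulus 1 and cancels against its conjugate.\<close>

lemma q_multiplicative_correlation_mod:
  assumes "q_multiplicative q \<theta>" "t \<ge> 1" "n mod q ^ t + h < q ^ t"
  shows "\<theta> (n + h) * cnj (\<theta> n) = \<theta> (n mod q ^ t + h) * cnj (\<theta> (n mod q ^ t))"
proof -
  let ?Q = "q ^ t" let ?a = "n div ?Q" and ?b = "n mod ?Q"
  have split: "\<theta> (?a * ?Q + b) = \<theta> (?a * ?Q) * \<theta> b" if "b < ?Q" for b
    using assms(1,2) that unfolding q_multiplicative_def by blast
  have "\<theta> (?a * ?Q) * cnj (\<theta> (?a * ?Q)) = 1"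
    using assms(1) by (simp add: q_multiplicative_def complex_norm_square[symmetric])
  moreover have "\<theta> (n + h) = \<theta> (?a * ?Q) * \<theta> (?b + h)"
    using split[OF assms(3)] by (simp only: add.assoc[symmetric] div_mult_mod_eq)
  moreover have "\<theta> n = \<theta> (?a * ?Q) * \<theta> ?b"
    using split[of ?b] assms(3) by (simp only: div_mult_mod_eq)
  ultimately show ?thesis by (simp add: algebra_simps)
qed

text \<open>Replacing \<open>n\<close> by \<open>n mod Q\<close> in the correlation gives a periodic
  sequence, which is orthogonal to \<open>z ^ n\<close> since \<open>z\<close> is not a root of
  unity. The error is confined to the carries, of density at most \<open>h / Q\<close>.\<close>

lemma cesaro_null_q_multiplicative_correlation:
  fixes z :: complex
  assumes q: "q \<ge> 2" and \<theta>: "q_multiplicative q \<theta>"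
    and z: "cmod z = 1" "\<And>d. d > 0 \<Longrightarrow> z ^ d \<noteq> 1"
  shows "cesaro_null (\<lambda>n. \<theta> (n + h) * cnj (\<theta> n) * z ^ n)"
proof (rule cesaro_null_approx)
  fix \<epsilon> :: real assume \<epsilon>: "\<epsilon> > 0"
  have \<theta>1: "cmod (\<theta> n) = 1" for n using \<theta> by (simp add: q_multiplicative_def)
  obtain t where t: "2 * real h / \<epsilon> < 2 ^ t"
    using real_arch_pow[of 2 "2 * real h / \<epsilon>"] by auto
  \<comment> \<open>\<open>Suc t\<close> makes the exponent at least 1, as multiplicativity
    demands.\<close>
  define Q where "Q = q ^ Suc t"
  have "(2::real) ^ t \<le> 2 ^ Suc t" by simp
  also have "\<dots> \<le> real q ^ Suc t" using q by (intro power_mono) auto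
  finally have hQ: "2 * real h \<le> \<epsilon> * real Q"
    using t \<epsilon> order_less_le_trans[of "2 * real h / \<epsilon>" "2 ^ t" "real q ^ Suc t"]
    by (simp add: Q_def divide_less_eq mult.commute less_imp_le)
  have Q0: "Q > 0" using q by (simp add: Q_def)
  define p where "p n = \<theta> (n mod Q + h) * cnj (\<theta> (n mod Q))" for n
  have "cesaro_null (\<lambda>n. p n * z ^ n)"
    by (rule cesaro_null_periodic_mult_power[of p Q]) (use z Q0 in \<open>simp_all add: p_def\<close>)
  moreover have "(\<Sum>n<N. cmod (\<theta> (n + h) * cnj (\<theta> n) * z ^ n - p n * z ^ n))
      \<le> \<epsilon> * real N + 2 * real h" for N
  proof -
    have le: "cmod (\<theta> (n + h) * cnj (\<theta> n) * z ^ n - p n * z ^ n)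
        \<le> (if Q \<le> n mod Q + h then 2 else 0)" for n
    proof (cases "Q \<le> n mod Q + h")
      case True
      have "cmod (\<theta> (n + h) * cnj (\<theta> n) * z ^ n - p n * z ^ n)
          \<le> cmod (\<theta> (n + h) * cnj (\<theta> n) * z ^ n) + cmod (p n * z ^ n)"
        by (rule norm_triangle_ineq4)
      also have "\<dots> = 2" by (simp add: p_def norm_mult norm_power \<theta>1 z)
      finally show ?thesis using True by simp
    next
      case False
      then have "\<theta> (n + h) * cnj (\<theta> n) = p n"
        unfolding p_def Q_def by (intro q_multiplicative_correlation_mod[OF \<theta>]) auto
      then show ?thesis using False by simp
    qed
    have "(\<Sum>n<N. cmod (\<theta> (n + h) * cnj (\<theta> n) * z ^ n - p n * z ^ n))
        \<le> (\<Sum>n<N. if Q \<le> n mod Q + h then 2 else 0)"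
      by (rule sum_mono) (rule le)
    also have "\<dots> = 2 * real (card {n. n < N \<and> Q \<le> n mod Q + h})"
      by (simp add: sum.If_cases Int_def)
    also have "\<dots> \<le> 2 * real ((N div Q + 1) * h)"
      using card_mod_ge_le[OF Q0, of N h] by (simp only: of_nat_le_iff mult_le_cancel_left_pos)
    \<comment> \<open>Each of the \<open>N div Q\<close> complete blocks costs \<open>2 * h\<close>,
      at most \<open>\<epsilon> * Q\<close>; the last, partial block goes into the constant.\<close>
    also have "\<dots> = real (N div Q) * (2 * real h) + 2 * real h" by (simp add: algebra_simps)
    also have "\<dots> \<le> real (N div Q) * (\<epsilon> * real Q) + 2 * real h"
      using hQ by (simp add: mult_left_mono)
    also have "\<dots> = \<epsilon> * real (N div Q * Q) + 2 * real h" by simp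
    also have "\<dots> \<le> \<epsilon> * real N + 2 * real h"
      using \<epsilon> by (simp del: of_nat_mult)
    finally show ?thesis .
  qed
  ultimately show "\<exists>w C. cesaro_null w \<and>
      (\<forall>N. (\<Sum>n<N. cmod (\<theta> (n + h) * cnj (\<theta> n) * z ^ n - w n)) \<le> \<epsilon> * real N + C)"
    by blast
qed

section \<open>Quadratic phases at irrational and rational frequencies\<close>

lemma cis_irrational_power_neq_1:
  assumes "x \<notin> \<rat>" "d > 0"
  shows "cis (2 * pi * x) ^ d \<noteq> 1"
proof
  assume "cis (2 * pi * x) ^ d = 1"
  then have "cos (real d * (2 * pi * x)) = 1"
    unfolding Complex.DeMoivre by (simp add: complex_eq_iff)
  then obtain k :: int where "real d * (2 * pi * x) = of_int k * 2 * pi"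
    using cos_one_2pi_int by blast
  then have "x = of_int k / of_nat d" using assms(2) by (simp add: field_simps)
  then show False using assms(1) by simp
qed

text \<open>For \<open>\<alpha> = a / d\<close>, passing from \<open>k\<close> to
  \<open>k + d\<close> changes \<open>k ^ 2 * \<alpha>\<close> by the integer
  \<open>a * (2 * k + d)\<close>, so the phase is \<open>d\<close>-periodic.\<close>

lemma cesaro_null_quadratic_rational:
  assumes "empty_spectrum \<theta>" "\<alpha> \<in> \<rat>"
  shows "cesaro_null (\<lambda>k. \<theta> k * cis (2 * pi * (real k ^ 2 * \<alpha>)))"
proof -
  obtain a :: int and d :: nat where d: "d > 0" and \<alpha>: "\<alpha> = of_int a / of_nat d"
    using assms(2) by (metis Rats_cases' of_int_of_nat_eq pos_int_cases)
  show ?thesis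
  proof (rule cesaro_null_empty_spectrum_mult_periodic[OF assms(1) _ d])
    fix k
    have "2 * pi * (real (k + d) ^ 2 * \<alpha>)
        = 2 * pi * (real k ^ 2 * \<alpha>) + 2 * pi * of_int (a * (2 * int k + int d))"
      using d by (simp add: \<alpha> field_simps power2_eq_square)
    then have "cis (2 * pi * (real (k + d) ^ 2 * \<alpha>))
        = cis (2 * pi * (real k ^ 2 * \<alpha>)) * cis (2 * pi * of_int (a * (2 * int k + int d)))"
      by (simp only: cis_mult)
    then show "cis (2 * pi * (real (k + d) ^ 2 * \<alpha>)) = cis (2 * pi * (real k ^ 2 * \<alpha>))"
      by (simp only: cis_multiple_2pi Ints_of_int mult_1_right)
  qed
qed

text \<open>Differencing makes the phase linear:
  \<open>(n + h) ^ 2 - n ^ 2 = 2 * h * n + h ^ 2\<close>. The lag \<open>h\<close> correlation is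
  thus a constant times that of \<theta> times \<open>z ^ n\<close>, where \<open>z\<close> has the
  irrational frequency \<open>2 * h * \<alpha>\<close>.\<close>

lemma cesaro_null_quadratic_irrational:
  assumes q: "q \<ge> 2" and \<theta>: "q_multiplicative q \<theta>" and \<alpha>: "\<alpha> \<notin> \<rat>"
  shows "cesaro_null (\<lambda>k. \<theta> k * cis (2 * pi * (real k ^ 2 * \<alpha>)))"
proof (rule van_der_Corput)
  show "cmod (\<theta> n * cis (2 * pi * (real n ^ 2 * \<alpha>))) \<le> 1" for n
    using \<theta> by (simp add: q_multiplicative_def norm_mult)
  fix h :: nat assume h: "h \<ge> 1"
  define z where "z = cis (2 * pi * (2 * real h * \<alpha>))"
  have irr: "2 * real h * \<alpha> \<notin> \<rat>"
  proof
    assume "2 * real h * \<alpha> \<in> \<rat>"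
    then have "(2 * real h * \<alpha>) / (2 * real h) \<in> \<rat>" by (intro Rats_divide) auto
    then show False using \<alpha> h by simp
  qed
  have "cesaro_null (\<lambda>n. cis (2 * pi * (real h ^ 2 * \<alpha>)) * (\<theta> (n + h) * cnj (\<theta> n) * z ^ n))"
    by (intro cesaro_null_cmult cesaro_null_q_multiplicative_correlation[OF q \<theta>])
      (use cis_irrational_power_neq_1[OF irr] in \<open>simp_all add: z_def\<close>)
  moreover have "cis (2 * pi * (real (n + h) ^ 2 * \<alpha>)) * cnj (cis (2 * pi * (real n ^ 2 * \<alpha>)))
      = cis (2 * pi * (real h ^ 2 * \<alpha>)) * z ^ n" for n
    unfolding z_def Complex.DeMoivre cis_cnj cis_mult
    by (rule arg_cong[of _ _ cis]) (simp add: power2_eq_square algebra_simps)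
  then have "\<theta> (n + h) * cis (2 * pi * (real (n + h) ^ 2 * \<alpha>)) * cnj (\<theta> n * cis (2 * pi * (real n ^ 2 * \<alpha>)))
      = cis (2 * pi * (real h ^ 2 * \<alpha>)) * (\<theta> (n + h) * cnj (\<theta> n) * z ^ n)" for n
    by (simp only: complex_cnj_mult mult_ac)
  ultimately show "cesaro_null (\<lambda>n. \<theta> (n + h) * cis (2 * pi * (real (n + h) ^ 2 * \<alpha>))
      * cnj (\<theta> n * cis (2 * pi * (real n ^ 2 * \<alpha>))))"
    by (simp only:)
qed

theorem proposition2:
  fixes q :: nat and \<theta> :: "nat \<Rightarrow> complex" and \<alpha> :: real
  assumes "q \<ge> 2"
    and "q_multiplicative q \<theta>"
    and "empty_spectrum \<theta>"
  shows "(\<lambda>N::nat. 1 / of_nat N *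
           (\<Sum>k=1..N. \<theta> k * exp (2 * \<i> * of_real pi * of_nat (k ^ 2) * of_real \<alpha>)))
         \<longlonglongrightarrow> 0"
proof -
  let ?u = "\<lambda>k. \<theta> k * cis (2 * pi * (real k ^ 2 * \<alpha>))"
  have u: "\<theta> k * exp (2 * \<i> * of_real pi * of_nat (k ^ 2) * of_real \<alpha>) = ?u k" for k
    unfolding cis_conv_exp by (simp add: mult_ac)
  have "cesaro_null ?u"
    using cesaro_null_quadratic_rational cesaro_null_quadratic_irrational assms by blast
  moreover have "cmod (?u k) \<le> 1" for k
    using assms(2) by (simp add: q_multiplicative_def norm_mult)
  \<comment> \<open>The claim sums over \<open>1..N\<close>, whereas \<open>cesaro_null\<close> sums
    over \<open>n < N\<close>; a shift by one reconciles them.\<close>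
  ultimately have "cesaro_null (\<lambda>n. ?u (n + 1))" by (rule cesaro_null_shift)
  moreover have "(\<Sum>k=1..N. ?u k) = (\<Sum>n<N. ?u (n + 1))" for N
    by (simp add: sum.shift_bounds_cl_Suc_ivl sum.atLeast1_atMost_eq)
  ultimately show ?thesis unfolding u by (simp add: cesaro_null_def)
qed

end
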